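(* Let $\Theta=(\Gamma,(x_{k,i}))$ be a patch framework in $\mathbb{R}^d$ with $\Gamma$ connected, with every view affinely non-degenerate, and with $m=2$ views. Let $S\in\mathbb{O}(d)^2$ be a perfect alignment. Then $S$ is non-degenerate if and only if $\mathrm{rank}(\overline B_{1,2})\ge d-1$.
   Context: Patch framework. $\Gamma$ is a bipartite graph on $n+m$ vertices; vertex $k\in\{1,\dots,n\}$ represents the $k$th point and vertex $n+i$, $i\in\{1,\dots,m\}$, the $i$th view; $(k,i)\in E(\Gamma)$ means that point $k$ is in view $i$, with local coordinates $x_{k,i}\in\mathbb{R}^d$. The tuple $\Theta=(\Gamma,(x_{k,i}))$ is a patch framework. A view $i$ is affinely non-degenerate if it has at least $d+1$ points and the affine span of $\{x_{k,i}:(k,i)\in E(\Gamma)\}$ has dimension $d$. Put $e_{ki}=e_k-e_{n+i}\in\mathbb{R}^{n+m}$, $\varepsilon_i$ the $i$th standard basis vector of $\mathbb{R}^m$, $\mathcal{L}_\Gamma=\sum_{(k,i)\in E(\Gamma)}e_{ki}e_{ki}^T$, $B=\sum_{(k,i)\in E(\Gamma)}(\varepsilon_i\otimes I_d)x_{k,i}e_{ki}^T$, $D=\sum_{(k,i)\in E(\Gamma)}(\varepsilon_i\otimes I_d)x_{k,i}x_{k,i}^T(\varepsilon_i\otimes I_d)^T$, and $C=D-B\mathcal{L}_\Gamma^\dagger B^T\in\mathbb{R}^{md\times md}$ (positive semi-definite), where $\dagger$ is the Moore–Penrose pseudoinverse. An alignment is an element $S=[S_i]_1^m$ (vertical stack)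 of $\mathbb{O}(d)^m\subseteq\mathbb{R}^{md\times d}$; $F(S)=\mathrm{Tr}(CSS^T)$; $S$ is perfect if $F(S)=0$. Let $\pi:\mathbb{O}(d)^m\to\mathbb{O}(d)^{m-1}$, $\pi(S)=[S_{i+1}S_1^T]_{i=1}^{m-1}$ (identifying $\mathbb{O}(d)^m/_\sim$, $S\sim SQ$ for $Q\in\mathbb{O}(d)$, with $\mathbb{O}(d)^{m-1}$), and $\widetilde F:\mathbb{O}(d)^{m-1}\to\mathbb{R}$, $\widetilde F(\widetilde S)=\mathrm{Tr}\left(C\begin{bmatrix}I_d\\ \widetilde S\end{bmatrix}\begin{bmatrix}I_d\\ \widetilde S\end{bmatrix}^T\right)$. $S$ is non-degenerate if $\pi(S)$ is a local minimizer of $\widetilde F$ at which the Hessian is non-singular (at a critical point this does not depend on the Riemannian metric). For two views $i,j$, $B_{i,j}$ is the matrix whose columns are the $x_{k,i}$ (in increasing order of $k$) over all $k$ with $(k,i),(k,j)\in E(\Gamma)$; $n'$ is its number of columns and $\overline B_{i,j}=B_{i,j}(I_{n'}-(1/n')\mathbf{1}_{n'}\mathbf{1}_{n'}^T)$, with $\mathbf{1}_{n'}$ the all-ones vector. *)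

theory Defs
  imports "HOL-Analysis.Analysis"
begin

text \<open>
  Conventions. A patch framework is a pair of a bipartite edge relation
  \<open>E :: ('n \<times> 'v) set\<close> and local coordinates \<open>x :: 'n \<Rightarrow> 'v \<Rightarrow> real^'d\<close>. The points are
  the elements of \<open>'n\<close>, the views are the elements of \<open>'v\<close>, and the vertex set of the graph is
  the sum type \<open>'n + 'v\<close>. Only the values \<open>x k i\<close> with \<open>(k, i) \<in> E\<close> are used. The rows and
  columns of an md-by-md matrix are indexed by \<open>'v \<times> 'd\<close> (block, position in the block).
  Where a first view is singled out, \<open>'v\<close> is \<open>'r option\<close>: the first view is \<open>None\<close> and
  the remaining m - 1 views are the \<open>Some i\<close>.
\<close>

section \<open>Patch frameworks\<close>

definition graph_adj :: "('n \<times> 'v) set \<Rightarrow> (('n + 'v) \<times> ('n + 'v)) set" where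
  "graph_adj E = {(Inl k, Inr i) | k i. (k, i) \<in> E} \<union> {(Inr i, Inl k) | k i. (k, i) \<in> E}"

definition graph_connected :: "('n \<times> 'v) set \<Rightarrow> bool" where
  "graph_connected E \<longleftrightarrow> (\<forall>u v. (u, v) \<in> (graph_adj E)\<^sup>*)"

definition affinely_nondegenerate_view ::
    "('n::finite \<times> 'v) set \<Rightarrow> ('n \<Rightarrow> 'v \<Rightarrow> real^'d) \<Rightarrow> 'v \<Rightarrow> bool" where
  "affinely_nondegenerate_view E x i \<longleftrightarrow>
     CARD('d) + 1 \<le> card {k. (k, i) \<in> E} \<and>
     aff_dim (affine hull {x k i | k. (k, i) \<in> E}) = int CARD('d)"

section \<open>The matrices of the alignment problem\<close>

definition outer :: "real^'b \<Rightarrow> real^'c \<Rightarrow> real^'c^'b" where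
  "outer u v = (\<chi> p q. u $ p * v $ q)"

definition kron_vec :: "real^'v \<Rightarrow> real^'c^'d \<Rightarrow> real^'c^('v \<times> 'd)" where
  "kron_vec u A = (\<chi> p q. u $ fst p * A $ snd p $ q)"

text \<open>\<open>view_block i\<close> is the Kronecker product of the \<open>i\<close>th standard basis vector and the identity.\<close>

definition view_block :: "'v::finite \<Rightarrow> real^'d^('v \<times> 'd)" where
  "view_block i = kron_vec (axis i 1) (mat 1)"

definition edge_vec :: "'n \<times> 'v \<Rightarrow> real^('n::finite + 'v::finite)" where
  "edge_vec = (\<lambda>(k, i). axis (Inl k) 1 - axis (Inr i) 1)"

definition laplacian ::
    "('n::finite \<times> 'v::finite) set \<Rightarrow> real^('n + 'v)^('n + 'v)" where
  "laplacian E = (\<Sum>(k, i)\<in>E. outer (edge_vec (k, i)) (edge_vec (k, i)))"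

definition patch_B ::
    "('n::finite \<times> 'v::finite) set \<Rightarrow> ('n \<Rightarrow> 'v \<Rightarrow> real^'d) \<Rightarrow> real^('n + 'v)^('v \<times> 'd)" where
  "patch_B E x = (\<Sum>(k, i)\<in>E. view_block i ** outer (x k i) (edge_vec (k, i)))"

definition patch_D ::
    "('n::finite \<times> 'v::finite) set \<Rightarrow> ('n \<Rightarrow> 'v \<Rightarrow> real^'d) \<Rightarrow> real^('v \<times> 'd)^('v \<times> 'd)" where
  "patch_D E x =
     (\<Sum>(k, i)\<in>E. view_block i ** outer (x k i) (x k i) ** transpose (view_block i))"

definition is_moore_penrose :: "real^'b^'c \<Rightarrow> real^'c^'b \<Rightarrow> bool" where
  "is_moore_penrose A X \<longleftrightarrow>
     A ** X ** A = A \<and> X ** A ** X = X \<and>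
     transpose (A ** X) = A ** X \<and> transpose (X ** A) = X ** A"

definition pinv :: "real^'b^'c \<Rightarrow> real^'c^'b" where
  "pinv A = (THE X. is_moore_penrose A X)"

definition patch_C ::
    "('n::finite \<times> 'v::finite) set \<Rightarrow> ('n \<Rightarrow> 'v \<Rightarrow> real^'d) \<Rightarrow> real^('v \<times> 'd)^('v \<times> 'd)" where
  "patch_C E x =
     patch_D E x - patch_B E x ** pinv (laplacian E) ** transpose (patch_B E x)"

section \<open>Alignments\<close>

definition orth_tuples :: "(real^'d^'d^'v) set" where
  "orth_tuples = {S. \<forall>i. orthogonal_matrix (S $ i)}"

definition stack :: "real^'d^'d^'v \<Rightarrow> real^'d^('v \<times> 'd)" where
  "stack S = (\<chi> p q. S $ fst p $ snd p $ q)"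

definition align_F ::
    "('n::finite \<times> 'v::finite) set \<Rightarrow> ('n \<Rightarrow> 'v \<Rightarrow> real^'d) \<Rightarrow> real^'d^'d^'v \<Rightarrow> real" where
  "align_F E x S = trace (patch_C E x ** stack S ** transpose (stack S))"

definition perfect_alignment ::
    "('n::finite \<times> 'v::finite) set \<Rightarrow> ('n \<Rightarrow> 'v \<Rightarrow> real^'d) \<Rightarrow> real^'d^'d^'v \<Rightarrow> bool" where
  "perfect_alignment E x S \<longleftrightarrow> S \<in> orth_tuples \<and> align_F E x S = 0"

definition quot_proj :: "real^'d^'d^('r::finite option) \<Rightarrow> real^'d^'d^'r" where
  "quot_proj S = (\<chi> i. S $ Some i ** transpose (S $ None))"

definition cons_id :: "real^'d^'d^'r \<Rightarrow> real^'d^'d^('r::finite option)" where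
  "cons_id T = (\<chi> v. case v of None \<Rightarrow> mat 1 | Some i \<Rightarrow> T $ i)"

definition quot_F ::
    "('n::finite \<times> 'r::finite option) set \<Rightarrow> ('n \<Rightarrow> 'r option \<Rightarrow> real^'d) \<Rightarrow> real^'d^'d^'r \<Rightarrow> real"
  where
  "quot_F E x T =
     trace (patch_C E x ** stack (cons_id T) ** transpose (stack (cons_id T)))"

section \<open>Hessians on embedded submanifolds\<close>

text \<open>
  Here \<open>M\<close> is meant to be an embedded submanifold of a Euclidean space, with the induced
  Riemannian metric. The Levi-Civita connection of that metric is the tangential part of the
  ambient derivative, so the Riemannian Hessian form of \<open>f\<close> at \<open>p\<close> is
  \<open>(u, v) \<mapsto> D(grad f)(p)[u] \<bullet> v\<close> on the tangent space. Derivatives \<open>at p within M\<close> are determined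
  only on tangent vectors, and only their values there are used.
\<close>

definition tangent_space :: "'a::euclidean_space set \<Rightarrow> 'a \<Rightarrow> 'a set" where
  "tangent_space M p =
     {v. \<exists>\<gamma> \<epsilon>. 0 < \<epsilon> \<and> \<gamma> C1_differentiable_on {-\<epsilon><..<\<epsilon>} \<and> \<gamma> ` {-\<epsilon><..<\<epsilon>} \<subseteq> M \<and>
              \<gamma> 0 = p \<and> (\<gamma> has_vector_derivative v) (at 0)}"

definition riem_grad :: "'a::euclidean_space set \<Rightarrow> ('a \<Rightarrow> real) \<Rightarrow> 'a \<Rightarrow> 'a" where
  "riem_grad M f p =
     (THE g. g \<in> tangent_space M p \<and>
             (\<forall>v\<in>tangent_space M p. frechet_derivative f (at p within M) v = g \<bullet> v))"

definition riem_hessian ::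
    "'a::euclidean_space set \<Rightarrow> ('a \<Rightarrow> real) \<Rightarrow> 'a \<Rightarrow> 'a \<Rightarrow> 'a \<Rightarrow> real" where
  "riem_hessian M f p u v = frechet_derivative (riem_grad M f) (at p within M) u \<bullet> v"

definition hessian_nonsingular :: "'a::euclidean_space set \<Rightarrow> ('a \<Rightarrow> real) \<Rightarrow> 'a \<Rightarrow> bool" where
  "hessian_nonsingular M f p \<longleftrightarrow>
     (\<forall>u\<in>tangent_space M p. (\<forall>v\<in>tangent_space M p. riem_hessian M f p u v = 0) \<longrightarrow> u = 0)"

definition local_minimizer_on :: "'a::euclidean_space set \<Rightarrow> ('a \<Rightarrow> real) \<Rightarrow> 'a \<Rightarrow> bool" where
  "local_minimizer_on M f p \<longleftrightarrow> p \<in> M \<and> (\<exists>\<epsilon>>0. \<forall>q\<in>M. dist q p < \<epsilon> \<longrightarrow> f p \<le> f q)"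

definition nondegenerate_alignment ::
    "('n::finite \<times> 'r::finite option) set \<Rightarrow> ('n \<Rightarrow> 'r option \<Rightarrow> real^'d) \<Rightarrow>
     real^'d^'d^('r option) \<Rightarrow> bool" where
  "nondegenerate_alignment E x S \<longleftrightarrow>
     local_minimizer_on orth_tuples (quot_F E x) (quot_proj S) \<and>
     hessian_nonsingular orth_tuples (quot_F E x) (quot_proj S)"

section \<open>Overlaps of two views\<close>

text \<open>
  The number of columns of these matrices depends on the graph, so a matrix with
  rows indexed by \<open>'d\<close> is represented by the list of its columns; its rank is the dimension of
  the column space.
\<close>

definition overlap_cols ::
    "('n::{finite,linorder} \<times> 'v) set \<Rightarrow> ('n \<Rightarrow> 'v \<Rightarrow> real^'d) \<Rightarrow> 'v \<Rightarrow> 'v \<Rightarrow> (real^'d) list" where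
  "overlap_cols E x i j =
     map (\<lambda>k. x k i) (sorted_list_of_set {k. (k, i) \<in> E \<and> (k, j) \<in> E})"

text \<open>\<open>center_cols\<close> is right multiplication by the centering matrix, whose \<open>(a, b)\<close> entry is
  \<open>(if a = b then 1 else 0) - 1/n'\<close>.\<close>

definition center_cols :: "(real^'d) list \<Rightarrow> (real^'d) list" where
  "center_cols cs =
     (let n' = length cs in
      map (\<lambda>b. \<Sum>a<n'. ((if a = b then 1 else 0) - 1 / real n') *\<^sub>R (cs ! a)) [0..<n'])"

definition cols_rank :: "(real^'d) list \<Rightarrow> nat" where
  "cols_rank cs = dim (span (set cs))"

end

theory Submission
  imports Defs
begin

text \<open>
  Minimizing over point positions and translations eliminates the pseudoinverse: with two views,
  \<open>F S\<close> is half the sum of \<open>\<parallel>S\<^sub>1\<^sup>T a\<^sub>k - S\<^sub>2\<^sup>T b\<^sub>k\<parallel>\<^sup>2\<close> over the common points, where \<open>a\<^sub>k\<close> and \<open>b\<^sub>k\<close>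
  are the centered coordinates of point \<open>k\<close> in the two views. On the orthogonal group the
  reduced cost is therefore affine, \<open>T \<mapsto> c - K \<bullet> T\<close> with \<open>K\<close> the sum of the \<open>b\<^sub>k a\<^sub>k\<^sup>T\<close>. At a
  perfect alignment \<open>b\<^sub>k = T a\<^sub>k\<close>, so \<open>K = T P\<close> with \<open>P\<close> the Gram matrix, the sum of the \<open>a\<^sub>k a\<^sub>k\<^sup>T\<close>, and
  the Hessian at \<open>T\<close> is \<open>(T \<Omega>, T \<Omega>') \<mapsto> (\<Omega> P + P \<Omega>) \<bullet> \<Omega>' / 2\<close> for skew-symmetric \<open>\<Omega>\<close>, \<open>\<Omega>'\<close>. Its
  value on the diagonal is the sum of the \<open>\<parallel>\<Omega> a\<^sub>k\<parallel>\<^sup>2\<close>, and a nonzero skew-symmetric \<open>\<Omega>\<close> can vanish on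
  all \<open>a\<^sub>k\<close> iff these span a space of codimension at least 2.
\<close>

section \<open>Matrix algebra\<close>

text \<open>Interpreting \<open>bounded_bilinear\<close> below gives distributivity over sums,
  product rules and continuity for matrix products at once.\<close>

lemma bounded_bilinear_matrix_mult:
  "bounded_bilinear ((**) :: real^'b^'a \<Rightarrow> real^'c^'b \<Rightarrow> real^'c^'a)"
proof -
  have "bilinear ((**) :: real^'b^'a \<Rightarrow> real^'c^'b \<Rightarrow> real^'c^'a)"
    unfolding bilinear_def
    by (auto intro!: linearI simp: matrix_add_ldistrib matrix_scalar_ac scalar_matrix_assoc)
       (auto simp: vec_eq_iff matrix_matrix_mult_def sum.distrib algebra_simps)
  then show ?thesis
    by (simp add: bilinear_conv_bounded_bilinear)
qed

interpretation matrix_mult: bounded_bilinear "(**) :: real^'b^'a \<Rightarrow> real^'c^'b \<Rightarrow> real^'c^'a"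
  by (rule bounded_bilinear_matrix_mult)

lemma bounded_linear_transpose:
  "bounded_linear (transpose :: real^'b^'a \<Rightarrow> real^'a^'b)"
  unfolding linear_conv_bounded_linear[symmetric]
  by (rule linearI) (auto simp: transpose_def vec_eq_iff)

lemmas transpose_add = linear_add[OF bounded_linear.linear[OF bounded_linear_transpose]]
lemmas transpose_diff = linear_diff[OF bounded_linear.linear[OF bounded_linear_transpose]]
lemmas transpose_sum = linear_sum[OF bounded_linear.linear[OF bounded_linear_transpose]]
lemmas transpose_zero = linear_0[OF bounded_linear.linear[OF bounded_linear_transpose]]

lemma bounded_linear_matrix_vector_left:
  fixes v :: "real^'b"
  shows "bounded_linear (\<lambda>A :: real^'b^'a. A *v v)"
  unfolding linear_conv_bounded_linear[symmetric]
  by (rule linearI) (auto simp: algebra_simps scaleR_matrix_vector_assoc)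

lemmas sum_matrix_vector_mult = linear_sum[OF bounded_linear.linear[OF bounded_linear_matrix_vector_left]]

lemma inner_transpose_mult: "(transpose A *v y) \<bullet> z = y \<bullet> (A *v z)" for A :: "real^'b^'a"
  by (simp add: dot_lmul_matrix)

lemma outer_mult_vec: "outer u v *v w = (v \<bullet> w) *\<^sub>R u"
  by (simp add: vec_eq_iff outer_def matrix_vector_mult_def inner_vec_def sum_distrib_left mult_ac)

lemma transpose_outer [simp]: "transpose (outer u v) = outer v u"
  by (simp add: vec_eq_iff outer_def transpose_def)

lemma outer_mult_outer: "outer u v ** outer w z = (v \<bullet> w) *\<^sub>R outer u z"
  by (simp add: vec_eq_iff outer_def matrix_matrix_mult_def inner_vec_def sum_distrib_left
      sum_distrib_right mult_ac)

lemma mult_outer: "A ** outer u v = outer (A *v u) v"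
  by (simp add: vec_eq_iff outer_def matrix_matrix_mult_def matrix_vector_mult_def
      sum_distrib_left mult_ac)

lemma outer_mult: "outer u v ** A = outer u (transpose A *v v)"
  by (simp add: vec_eq_iff outer_def matrix_matrix_mult_def vector_matrix_mult_def
      sum_distrib_left mult_ac)

lemma outer_inner: "outer u v \<bullet> A = u \<bullet> (A *v v)"
  by (simp add: inner_vec_def outer_def matrix_vector_mult_def sum_distrib_left mult_ac)

lemma inner_transpose_transpose: "transpose A \<bullet> transpose B = A \<bullet> B" for A B :: "real^'b^'a"
  by (simp add: inner_vec_def transpose_def sum.swap[of _ "UNIV :: 'a set"])

lemma inner_matrix_mult_left: "(A ** B) \<bullet> C = B \<bullet> (transpose A ** C)" for A :: "real^'b^'a"
proof -
  have "(A ** B) \<bullet> C = (\<Sum>i\<in>UNIV. \<Sum>j\<in>UNIV. \<Sum>k\<in>UNIV. A $ i $ k * B $ k $ j * C $ i $ j)"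
    by (simp add: inner_vec_def matrix_matrix_mult_def sum_distrib_right)
  also have "\<dots> = (\<Sum>i\<in>UNIV. \<Sum>k\<in>UNIV. \<Sum>j\<in>UNIV. A $ i $ k * B $ k $ j * C $ i $ j)"
    by (rule sum.cong[OF refl], rule sum.swap)
  also have "\<dots> = (\<Sum>k\<in>UNIV. \<Sum>i\<in>UNIV. \<Sum>j\<in>UNIV. A $ i $ k * B $ k $ j * C $ i $ j)"
    by (rule sum.swap)
  also have "\<dots> = (\<Sum>k\<in>UNIV. \<Sum>j\<in>UNIV. \<Sum>i\<in>UNIV. A $ i $ k * B $ k $ j * C $ i $ j)"
    by (rule sum.cong[OF refl], rule sum.swap)
  also have "\<dots> = B \<bullet> (transpose A ** C)"
    by (simp add: inner_vec_def matrix_matrix_mult_def transpose_def sum_distrib_left mult_ac)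
  finally show ?thesis .
qed

section \<open>The pseudoinverse of a symmetric matrix\<close>

text \<open>\<open>A ** X\<close> and \<open>A ** Y\<close> are symmetric projections onto the range
  of \<open>A\<close>, so they agree; likewise \<open>X ** A\<close> and \<open>Y ** A\<close>.
  Hence \<open>X = X ** A ** X = Y ** A ** Y = Y\<close>.\<close>

lemma is_moore_penrose_unique:
  assumes X: "is_moore_penrose A X" and Y: "is_moore_penrose A Y"
  shows "X = Y"
proof -
  have X': "A ** X ** A = A" "X ** A ** X = X" "transpose (A ** X) = A ** X" "transpose (X ** A) = X ** A"
    and Y': "A ** Y ** A = A" "Y ** A ** Y = Y" "transpose (A ** Y) = A ** Y" "transpose (Y ** A) = Y ** A"
    using X Y by (auto simp: is_moore_penrose_def)
  have "A ** X = transpose (A ** Y ** A ** X)"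
    using X' Y' by simp
  also have "\<dots> = (A ** X) ** (A ** Y)"
    by (metis X'(3) Y'(3) matrix_mul_assoc matrix_transpose_mul)
  also have "\<dots> = A ** Y"
    using X'(1) by (simp add: matrix_mul_assoc)
  finally have 1: "A ** X = A ** Y" .
  have "X ** A = transpose (X ** A ** Y ** A)"
    using X' Y' by (metis matrix_mul_assoc)
  also have "\<dots> = (Y ** A) ** (X ** A)"
    by (metis X'(4) Y'(4) matrix_mul_assoc matrix_transpose_mul)
  also have "\<dots> = Y ** A"
    using X'(1) by (metis matrix_mul_assoc)
  finally have 2: "X ** A = Y ** A" .
  show ?thesis
    by (metis 1 2 X'(2) Y'(2) matrix_mul_assoc)
qed

text \<open>\<open>P\<close> is the orthogonal projection onto the kernel: the sum of
  \<open>outer b b\<close> over an orthonormal basis of it.\<close>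

lemma ex_kernel_projection:
  fixes A :: "real^'a^'a"
  obtains P where "transpose P = P" "P ** P = P" "A ** P = 0" "\<And>v. A *v v = 0 \<Longrightarrow> P *v v = v"
proof -
  have sub: "subspace {v. A *v v = 0}"
    by (auto simp: subspace_def matrix_vector_right_distrib matrix_vector_mult_scaleR)
  obtain B where B: "B \<subseteq> {v. A *v v = 0}" "pairwise orthogonal B"
    "\<And>x. x \<in> B \<Longrightarrow> norm x = 1" "independent B" "span B = {v. A *v v = 0}"
    using orthonormal_basis_subspace[OF sub] by metis
  have fin: "finite B"
    using B(4) independent_imp_finite by blast
  define P where "P = (\<Sum>b\<in>B. outer b b)"
  have Pv: "P *v v = (\<Sum>b\<in>B. (v \<bullet> b) *\<^sub>R b)" for v
    by (simp add: P_def sum_matrix_vector_mult outer_mult_vec inner_commute)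
  have ker: "A *v (P *v v) = 0" for v
  proof -
    have "P *v v \<in> span B"
      unfolding Pv by (intro span_sum span_scale span_base)
    then show ?thesis using B(5) by auto
  qed
  have fixed: "P *v v = v" if "A *v v = 0" for v
    unfolding Pv using that B fin by (intro orthonormal_basis_expand) auto
  show ?thesis
  proof
    show "transpose P = P"
      by (simp add: P_def transpose_sum)
    show "P ** P = P"
      using fixed ker by (simp add: matrix_eq flip: matrix_vector_mul_assoc)
    show "A ** P = 0"
      using ker by (simp add: matrix_eq flip: matrix_vector_mul_assoc)
  qed (rule fixed)
qed

text \<open>With \<open>P\<close> the orthogonal projection onto the kernel, \<open>A + P\<close> is invertible and the
  pseudoinverse is \<open>(A + P)\<^sup>-\<^sup>1 - P\<close>.\<close>

lemma ex_moore_penrose_symmetric: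
  fixes A :: "real^'a^'a"
  assumes sym: "transpose A = A"
  shows "\<exists>X. is_moore_penrose A X"
proof -
  obtain P where P: "transpose P = P" "P ** P = P" "A ** P = 0"
    "\<And>v. A *v v = 0 \<Longrightarrow> P *v v = v"
    using ex_kernel_projection[of A] by metis
  have PA: "P ** A = 0"
    by (metis P(1,3) matrix_transpose_mul sym transpose_zero)
  \<comment> \<open>Multiplication by \<open>P\<close> removes \<open>A\<close>, so
    \<open>P *v v = 0\<close>; then \<open>A *v v = 0\<close> as well, and \<open>P\<close> fixes
    the kernel of \<open>A\<close>, so \<open>v = 0\<close>.\<close>
  have "v = 0" if v: "(A + P) *v v = 0" for v
  proof -
    have "P *v v = (P ** (A + P)) *v v"
      by (simp add: matrix_add_ldistrib PA P(2))
    also have "\<dots> = 0"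
      using v by (simp flip: matrix_vector_mul_assoc)
    finally have "P *v v = 0" .
    with v P(4)[of v] show ?thesis
      by (simp add: matrix_vector_mult_add_rdistrib)
  qed
  then obtain N where NM: "N ** (A + P) = mat 1"
    using matrix_left_invertible_ker[of "A + P"] by blast
  then have MN: "(A + P) ** N = mat 1"
    by (simp add: matrix_left_right_inverse)
  have NP: "N ** P = P"
  proof -
    have "N ** P = N ** ((A + P) ** P)"
      by (simp add: matrix_mult.add_left P)
    then show ?thesis
      by (simp add: matrix_mul_assoc NM)
  qed
  have PN: "P ** N = P"
  proof -
    have "P ** N = (P ** (A + P)) ** N"
      by (simp add: matrix_mult.add_right P PA)
    also have "\<dots> = P ** ((A + P) ** N)"
      by (simp only: matrix_mul_assoc)
    finally show ?thesis
      by (simp add: MN)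
  qed
  have AX: "A ** (N - P) = mat 1 - P"
    using MN by (simp add: matrix_mult.add_left matrix_mult.diff_right P PN algebra_simps)
  have XA: "(N - P) ** A = mat 1 - P"
    using NM by (simp add: matrix_mult.add_right matrix_mult.diff_left PA NP algebra_simps)
  have "is_moore_penrose A (N - P)"
    unfolding is_moore_penrose_def AX XA
    by (simp add: transpose_diff P PA PN matrix_mult.diff_left matrix_mult.diff_right)
  then show ?thesis ..
qed

text \<open>Existence and uniqueness together make the description in \<open>pinv\<close>
  meaningful. The symmetric case suffices, because \<open>pinv\<close> is applied only to the
  Laplacian.\<close>

lemma is_moore_penrose_pinv_symmetric:
  fixes A :: "real^'a^'a"
  assumes "transpose A = A"
  shows "is_moore_penrose A (pinv A)"
  unfolding pinv_def
  using ex_moore_penrose_symmetric[OF assms] is_moore_penrose_unique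
  by (metis (mono_tags, lifting) theI)

section \<open>The alignment cost\<close>

text \<open>Decouples the cost into one quadratic form for each of the d columns of the stacked
  alignment.\<close>

lemma trace_mult_gram:
  fixes A :: "real^'a^'a" and S :: "real^'b^'a"
  shows "trace (A ** S ** transpose S) = (\<Sum>q\<in>UNIV. column q S \<bullet> (A *v column q S))"
proof -
  have "trace (A ** S ** transpose S) = trace (transpose S ** (A ** S))"
    by (rule trace_mul_sym)
  also have "\<dots> = (\<Sum>q\<in>UNIV. column q S \<bullet> (A *v column q S))"
    by (simp add: trace_def matrix_matrix_mult_def matrix_vector_mult_def transpose_def
        column_def inner_vec_def)
  finally show ?thesis .
qed

lemma view_block_transpose_column_stack:
  "transpose (view_block i) *v column q (stack S) = column q (S $ i)"
proof -
  have "(transpose (view_block i) *v column q (stack S)) $ p = S $ i $ p $ q" for p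
  proof -
    have "(transpose (view_block i) *v column q (stack S)) $ p
      = (\<Sum>a\<in>UNIV. (if a = (i, p) then S $ fst a $ snd a $ q else 0))"
      unfolding matrix_vector_mult_def
      by (auto simp: transpose_def view_block_def kron_vec_def axis_def mat_def
          column_def stack_def prod_eq_iff intro!: sum.cong)
    then show ?thesis by simp
  qed
  then show ?thesis
    by (simp add: vec_eq_iff column_def del: transpose_matrix_vector)
qed

lemma transpose_laplacian: "transpose (laplacian E) = laplacian E"
  by (simp add: laplacian_def transpose_sum split_def)

lemma edge_vec_inner: "edge_vec (k, i) \<bullet> z = z $ Inl k - z $ Inr i"
  by (simp add: edge_vec_def inner_diff_left inner_axis')

lemma laplacian_mult_vec:
  "laplacian E *v z = (\<Sum>e\<in>E. (edge_vec e \<bullet> z) *\<^sub>R edge_vec e)"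
  by (simp add: laplacian_def sum_matrix_vector_mult split_def outer_mult_vec)

lemma patch_B_transpose_column_stack:
  "transpose (patch_B E x) *v column q (stack S)
    = (\<Sum>(k, i)\<in>E. (x k i \<bullet> column q (S $ i)) *\<^sub>R edge_vec (k, i))"
  by (simp add: patch_B_def transpose_sum sum_matrix_vector_mult split_def matrix_transpose_mul
      view_block_transpose_column_stack outer_mult_vec
      flip: matrix_vector_mul_assoc del: transpose_matrix_vector)

lemma patch_D_quadratic_form:
  "column q (stack S) \<bullet> (patch_D E x *v column q (stack S))
    = (\<Sum>(k, i)\<in>E. (x k i \<bullet> column q (S $ i))\<^sup>2)"
proof -
  have "s \<bullet> (view_block i ** outer u u ** transpose (view_block i) *v s)
      = (u \<bullet> (transpose (view_block i) *v s))\<^sup>2"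
    for s :: "real^('a \<times> 'b)" and u i
    by (simp only: matrix_vector_mul_assoc[symmetric] inner_transpose_mult[symmetric] outer_mult_vec)
       (simp add: power2_eq_square matrix_vector_mult_scaleR inner_commute flip: dot_lmul_matrix)
  then show ?thesis
    by (simp add: patch_D_def sum_matrix_vector_mult inner_sum_right split_def
        view_block_transpose_column_stack del: transpose_matrix_vector)
qed

text \<open>The coordinate of the sum at a point is the sum of the weights on its edges, and at a
  view the negative of that sum. With residuals as weights, this gives the normal equations.\<close>

lemma sum_edge_vec_eq_0:
  assumes "\<And>k. (\<Sum>i | (k, i) \<in> E. w k i) = 0" and "\<And>i. (\<Sum>k | (k, i) \<in> E. w k i) = (0::real)"
  shows "(\<Sum>(k, i)\<in>E. w k i *\<^sub>R edge_vec (k, i)) = 0"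
proof -
  have "(\<Sum>(k, i)\<in>E. w k i *\<^sub>R edge_vec (k, i)) $ v = 0" for v
  proof (cases v)
    case (Inl k)
    have "(\<Sum>(k, i)\<in>E. w k i *\<^sub>R edge_vec (k, i)) $ v = (\<Sum>e\<in>E. if fst e = k then w (fst e) (snd e) else 0)"
      by (auto simp: Inl edge_vec_def axis_def intro!: sum.cong)
    also have "\<dots> = (\<Sum>e | e \<in> E \<and> fst e = k. w (fst e) (snd e))"
      by (rule sum.inter_filter[symmetric]) simp
    also have "\<dots> = (\<Sum>i | (k, i) \<in> E. w k i)"
      by (rule sum.reindex_bij_witness[where i = "\<lambda>i. (k, i)" and j = snd]) auto
    finally show ?thesis using assms by simp
  next
    case (Inr i)
    have "(\<Sum>(k, i)\<in>E. w k i *\<^sub>R edge_vec (k, i)) $ v = (\<Sum>e\<in>E. if snd e = i then - w (fst e) (snd e) else 0)"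
      by (auto simp: Inr edge_vec_def axis_def intro!: sum.cong)
    also have "\<dots> = (\<Sum>e | e \<in> E \<and> snd e = i. - w (fst e) (snd e))"
      by (rule sum.inter_filter[symmetric]) simp
    also have "\<dots> = (\<Sum>k | (k, i) \<in> E. - w k i)"
      by (rule sum.reindex_bij_witness[where i = "\<lambda>k. (k, i)" and j = fst]) auto
    finally show ?thesis using assms by (simp add: sum_negf)
  qed
  then show ?thesis
    by (simp add: vec_eq_iff)
qed

text \<open>The hypotheses say that \<open>z\<close> is stationary for the inner least squares problem over the
  point positions and the translations of the views; \<open>z\<close> then solves the normal equations
  \<open>L z = B\<^sup>T S\<close>, and \<open>L L\<^sup>\<dagger> L = L\<close> eliminates the pseudoinverse.\<close>

lemma align_F_eq_residual:
  fixes E :: "('n::finite \<times> 'v::finite) set" and x :: "'n \<Rightarrow> 'v \<Rightarrow> real^'d"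
    and z :: "'n + 'v \<Rightarrow> real^'d"
  defines "r \<equiv> \<lambda>S k i. transpose (S $ i) *v x k i - (z (Inl k) - z (Inr i))"
  assumes "\<And>k. (\<Sum>i | (k, i) \<in> E. r S k i) = 0" and "\<And>i. (\<Sum>k | (k, i) \<in> E. r S k i) = 0"
  shows "align_F E x S = (\<Sum>(k, i)\<in>E. (norm (r S k i))\<^sup>2)"
proof -
  let ?L = "laplacian E"
  have column: "column q (stack S) \<bullet> (patch_C E x *v column q (stack S)) = (\<Sum>(k, i)\<in>E. (r S k i $ q)\<^sup>2)" for q
  proof -
    define s where "s = column q (stack S)"
    define w where "w e = x (fst e) (snd e) \<bullet> column q (S $ snd e)" for e
    define zq where "zq = (\<chi> v. z v $ q)"
    have rq: "r S k i $ q = w (k, i) - edge_vec (k, i) \<bullet> zq" for k i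
    proof -
      have "(transpose (S $ i) *v x k i) $ q = x k i \<bullet> column q (S $ i)"
        by (simp only: matrix_vector_mul_component)
           (simp add: inner_vec_def transpose_def column_def mult_ac)
      then show ?thesis
        by (simp add: r_def w_def edge_vec_inner zq_def del: transpose_matrix_vector)
    qed
    have normal: "transpose (patch_B E x) *v s = ?L *v zq"
    proof -
      have "(\<Sum>(k, i)\<in>E. (r S k i $ q) *\<^sub>R edge_vec (k, i)) = 0"
      proof (rule sum_edge_vec_eq_0)
        show "(\<Sum>i | (k, i) \<in> E. r S k i $ q) = 0" for k
          using assms(2)[of k] by (simp flip: sum_component)
        show "(\<Sum>k | (k, i) \<in> E. r S k i $ q) = 0" for i
          using assms(3)[of i] by (simp flip: sum_component)
      qed
      then show ?thesis
        by (simp add: s_def patch_B_transpose_column_stack laplacian_mult_vec rq w_def split_def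
            scaleR_diff_left sum_subtractf del: transpose_matrix_vector)
    qed
    \<comment> \<open>\<open>quad\<close> and \<open>cross\<close> evaluate the same number, the
      second through the normal equations. Writing it as twice \<open>cross\<close> minus
      \<open>quad\<close> completes the square below.\<close>
    have quad: "zq \<bullet> (?L *v zq) = (\<Sum>e\<in>E. (edge_vec e \<bullet> zq)\<^sup>2)"
      by (simp add: laplacian_mult_vec inner_sum_right power2_eq_square inner_commute)
    have cross: "zq \<bullet> (?L *v zq) = (\<Sum>e\<in>E. w e * (edge_vec e \<bullet> zq))"
      by (simp add: normal[symmetric] s_def patch_B_transpose_column_stack inner_sum_right w_def
          split_def inner_commute del: transpose_matrix_vector)
    have pinv: "?L ** pinv ?L ** ?L = ?L"
      using is_moore_penrose_pinv_symmetric[OF transpose_laplacian] by (auto simp: is_moore_penrose_def)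
    have "s \<bullet> (patch_B E x ** pinv ?L ** transpose (patch_B E x) *v s)
      = (transpose (patch_B E x) *v s) \<bullet> (pinv ?L *v (transpose (patch_B E x) *v s))"
      by (simp only: inner_transpose_mult matrix_vector_mul_assoc[symmetric])
    also have "\<dots> = zq \<bullet> ((?L ** pinv ?L ** ?L) *v zq)"
      unfolding normal
      by (metis inner_transpose_mult matrix_vector_mul_assoc transpose_laplacian)
    finally have B: "s \<bullet> (patch_B E x ** pinv ?L ** transpose (patch_B E x) *v s) = zq \<bullet> (?L *v zq)"
      by (simp add: pinv)
    have "s \<bullet> (patch_C E x *v s) = (\<Sum>e\<in>E. (w e)\<^sup>2) - zq \<bullet> (?L *v zq)"
      using B patch_D_quadratic_form[of q S E x]
      by (simp add: patch_C_def matrix_vector_mult_diff_rdistrib inner_diff_right s_def w_def split_def)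
    also have "\<dots> = (\<Sum>e\<in>E. (w e)\<^sup>2) - 2 * (\<Sum>e\<in>E. w e * (edge_vec e \<bullet> zq)) + (\<Sum>e\<in>E. (edge_vec e \<bullet> zq)\<^sup>2)"
      using quad cross by simp
    also have "\<dots> = (\<Sum>e\<in>E. (w e - edge_vec e \<bullet> zq)\<^sup>2)"
      by (simp add: power2_diff sum.distrib sum_subtractf sum_distrib_left mult_ac)
    finally show ?thesis
      by (simp add: s_def rq split_def)
  qed
  have "align_F E x S = (\<Sum>q\<in>UNIV. \<Sum>(k, i)\<in>E. (r S k i $ q)\<^sup>2)"
    by (simp add: align_F_def trace_mult_gram column)
  also have "\<dots> = (\<Sum>(k, i)\<in>E. \<Sum>q\<in>UNIV. (r S k i $ q)\<^sup>2)"
    by (simp add: split_def sum.swap[of _ E])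
  also have "\<dots> = (\<Sum>(k, i)\<in>E. (norm (r S k i))\<^sup>2)"
    by (simp only: power2_norm_eq_inner) (simp add: inner_vec_def power2_eq_square)
  finally show ?thesis .
qed

section \<open>Centering and the cost for two views\<close>

definition centered :: "'k set \<Rightarrow> ('k \<Rightarrow> 'a::real_vector) \<Rightarrow> 'k \<Rightarrow> 'a" where
  "centered A f k = f k - (\<Sum>l\<in>A. f l) /\<^sub>R real (card A)"

lemma sum_centered: "finite A \<Longrightarrow> (\<Sum>k\<in>A. centered A f k) = 0"
  by (cases "A = {}") (simp_all add: centered_def sum_subtractf sum_constant_scaleR)

lemma centered_diff: "centered A (\<lambda>k. f k - g k) k = centered A f k - centered A g k"
  by (simp add: centered_def sum_subtractf algebra_simps)

lemma linear_centered: "linear h \<Longrightarrow> h (centered A f k) = centered A (\<lambda>k. h (f k)) k"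
  by (simp add: centered_def linear_diff linear_cmul linear_sum)

abbreviation overlap :: "('n \<times> 'v) set \<Rightarrow> 'v \<Rightarrow> 'v \<Rightarrow> 'n set" where
  "overlap E i j \<equiv> {k. (k, i) \<in> E \<and> (k, j) \<in> E}"

abbreviation centered_view ::
    "('n \<times> 'v) set \<Rightarrow> ('n \<Rightarrow> 'v \<Rightarrow> real^'d) \<Rightarrow> 'v \<Rightarrow> 'v \<Rightarrow> 'v \<Rightarrow> 'n \<Rightarrow> real^'d" where
  "centered_view E x i j v \<equiv> centered (overlap E i j) (\<lambda>k. x k v)"

lemma sum_edges: "(\<Sum>(k, v)\<in>E. f k v) = (\<Sum>k\<in>UNIV. \<Sum>v | (k, v) \<in> E. f k v)"
  for E :: "('n::finite \<times> 'v::finite) set"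
  by (subst sum.Sigma) (auto intro!: sum.cong)

text \<open>A point seen by only one view can be placed without error. A common point is placed at
  the midpoint of its two aligned images, with residuals plus and minus half of the centered
  difference; their squared norms add up to half of its squared norm.\<close>

lemma align_F_two_views:
  fixes E :: "('n::finite \<times> 'v::finite) set" and x :: "'n \<Rightarrow> 'v \<Rightarrow> real^'d"
  assumes ij: "i \<noteq> j" "(UNIV :: 'v set) = {i, j}"
  shows "align_F E x S = (\<Sum>k\<in>overlap E i j.
    (norm (transpose (S $ i) *v centered_view E x i j i k
      - transpose (S $ j) *v centered_view E x i j j k))\<^sup>2) / 2"
proof -
  define O' where "O' = overlap E i j"
  define u where "u k v = transpose (S $ v) *v x k v" for k v
  define c where "c = centered O' (\<lambda>k. u k i - u k j)"
  \<comment> \<open>With the translation of view \<open>i\<close> fixed at 0, view \<open>j\<close>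
    is translated by the mean discrepancy \<tau>; this centers the differences \<open>c k\<close>,
    so the residuals of each view sum to 0.\<close>
  define \<tau> where "\<tau> = (\<Sum>l\<in>O'. u l i - u l j) /\<^sub>R real (card O')"
  define z where "z = case_sum
    (\<lambda>k. if k \<in> O' then (u k i + u k j + \<tau>) /\<^sub>R 2 else if (k, i) \<in> E then u k i else u k j + \<tau>)
    (\<lambda>v. if v = i then 0 else \<tau>)"
  define r where "r k v = u k v - (z (Inl k) - z (Inr v))" for k v
  have c_eq: "c k = u k i - u k j - \<tau>" for k
    by (simp add: c_def centered_def \<tau>_def)
  have ri: "r k i = (if k \<in> O' then c k /\<^sub>R 2 else 0)" if "(k, i) \<in> E" for k
    using that by (auto simp: r_def z_def c_eq vec_eq_iff field_simps)
  have rj: "r k j = (if k \<in> O' then - (c k /\<^sub>R 2) else 0)" if "(k, j) \<in> E" for k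
    using that ij(1) by (auto simp: r_def z_def c_eq O'_def vec_eq_iff field_simps)
  have views: "{v. (k, v) \<in> E} = (if (k, i) \<in> E then {i} else {}) \<union> (if (k, j) \<in> E then {j} else {})" for k
    using ij(2) by auto
  have sum_c: "(\<Sum>k\<in>O'. c k) = 0"
    by (simp add: c_def sum_centered)
  have sum_O: "(\<Sum>k | (k, v) \<in> E. if k \<in> O' then f k else 0) = (\<Sum>k\<in>O'. f k)"
    if "v = i \<or> v = j" for v and f :: "'n \<Rightarrow> real^'d"
    using that by (intro sum.mono_neutral_cong_right) (auto simp: O'_def)
  have "(\<Sum>v | (k, v) \<in> E. r k v) = 0" for k
    using ij(1) ri[of k] rj[of k] by (auto simp: views O'_def)
  moreover have "(\<Sum>k | (k, v) \<in> E. r k v) = 0" for v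
  proof -
    consider "v = i" | "v = j" using ij(2) by auto
    then show ?thesis
    proof cases
      case 1
      have "(\<Sum>k | (k, i) \<in> E. r k i) = (\<Sum>k\<in>O'. c k /\<^sub>R 2)"
        using sum_O[of i "\<lambda>k. c k /\<^sub>R 2"] ri by simp
      then show ?thesis using sum_c 1 by (simp flip: scaleR_right.sum)
    next
      case 2
      have "(\<Sum>k | (k, j) \<in> E. r k j) = (\<Sum>k\<in>O'. - (c k /\<^sub>R 2))"
        using sum_O[of j "\<lambda>k. - (c k /\<^sub>R 2)"] rj by simp
      then show ?thesis using sum_c 2 by (simp add: sum_negf flip: scaleR_right.sum)
    qed
  qed
  ultimately have "align_F E x S = (\<Sum>(k, v)\<in>E. (norm (r k v))\<^sup>2)"
    using align_F_eq_residual[of S x z E] by (simp add: r_def u_def)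
  also have "\<dots> = (\<Sum>k\<in>UNIV. \<Sum>v | (k, v) \<in> E. (norm (r k v))\<^sup>2)"
    by (rule sum_edges)
  also have "\<dots> = (\<Sum>k\<in>UNIV. if k \<in> O' then (norm (c k))\<^sup>2 / 2 else 0)"
  proof (rule sum.cong)
    show "(\<Sum>v | (k, v) \<in> E. (norm (r k v))\<^sup>2) = (if k \<in> O' then (norm (c k))\<^sup>2 / 2 else 0)" for k
      using ij(1) ri[of k] rj[of k] by (auto simp: views O'_def power_mult_distrib power_divide)
  qed simp
  also have "\<dots> = (\<Sum>k\<in>O'. (norm (c k))\<^sup>2) / 2"
    by (simp add: sum.If_cases sum_divide_distrib)
  also have "c = (\<lambda>k. transpose (S $ i) *v centered_view E x i j i k
      - transpose (S $ j) *v centered_view E x i j j k)"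
    unfolding c_def u_def O'_def
    by (rule ext) (simp only: centered_diff linear_centered[OF matrix_vector_mul_linear])
  finally show ?thesis
    by (simp add: O'_def)
qed

text \<open>The centered list has the centered coordinates of the common points as its entries, and
  the span depends only on the set of entries.\<close>

lemma cols_rank_center_overlap:
  "cols_rank (center_cols (overlap_cols E x i j))
    = dim (span (centered_view E x i j i ` overlap E i j))"
proof -
  define ks where "ks = sorted_list_of_set (overlap E i j)"
  define cs where "cs = overlap_cols E x i j"
  have cs: "cs = map (\<lambda>k. x k i) ks"
    by (simp add: cs_def overlap_cols_def ks_def)
  have ks: "set ks = overlap E i j" "distinct ks" "length ks = card (overlap E i j)"
    by (simp_all add: ks_def)
  have total: "(\<Sum>a<length ks. x (ks ! a) i) = (\<Sum>k\<in>overlap E i j. x k i)"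
    by (rule sum.reindex_bij_betw[OF bij_betw_nth[OF ks(2) refl ks(1)[symmetric]]])
  have "(\<Sum>a<length ks. ((if a = b then 1 else 0) - 1 / real (length ks)) *\<^sub>R (cs ! a))
    = centered_view E x i j i (ks ! b)" if "b < length ks" for b
  proof -
    have "(\<Sum>a<length ks. ((if a = b then 1 else 0) - 1 / real (length ks)) *\<^sub>R (cs ! a))
      = (\<Sum>a<length ks. (if a = b then x (ks ! a) i else 0) - (1 / real (length ks)) *\<^sub>R x (ks ! a) i)"
      by (intro sum.cong) (auto simp: cs scaleR_diff_left)
    also have "\<dots> = x (ks ! b) i - (1 / real (length ks)) *\<^sub>R (\<Sum>a<length ks. x (ks ! a) i)"
      using that by (simp add: sum_subtractf scaleR_right.sum)
    also have "\<dots> = centered_view E x i j i (ks ! b)"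
      using total by (simp add: centered_def ks(3) inverse_eq_divide)
    finally show ?thesis .
  qed
  then have "set (center_cols cs) = (\<lambda>b. centered_view E x i j i (ks ! b)) ` {..<length ks}"
    by (simp add: center_cols_def Let_def cs atLeast0LessThan)
  also have "\<dots> = centered_view E x i j i ` overlap E i j"
    unfolding ks(1)[symmetric] set_conv_nth by auto
  finally show ?thesis
    by (simp add: cols_rank_def cs_def)
qed

section \<open>Riemannian geometry of tuples of orthogonal matrices\<close>

definition skew_symmetric :: "real^'d^'d \<Rightarrow> bool" where
  "skew_symmetric A \<longleftrightarrow> transpose A = - A"

text \<open>These are the elements of the Lie algebra of the orthogonal group, described by curves.
  Curves on the whole line with an explicit continuous derivative can be multiplied without
  shrinking intervals and yield \<open>C1_differentiable_on\<close> directly.\<close>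

definition orth_velocities :: "(real^'d^'d) set" where
  "orth_velocities = {A. \<exists>\<gamma> \<gamma>'. (\<forall>t. (\<gamma> has_vector_derivative \<gamma>' t) (at t)) \<and> continuous_on UNIV \<gamma>' \<and>
     (\<forall>t. orthogonal_matrix (\<gamma> t)) \<and> \<gamma> 0 = mat 1 \<and> \<gamma>' 0 = A}"

text \<open>Both curves pass through the identity at 0, so the product rule gives their pointwise
  product the velocity \<open>A + B\<close>. Sums thus need no exponential of a general
  skew-symmetric matrix.\<close>

lemma orth_velocities_add:
  assumes "A \<in> orth_velocities" "B \<in> orth_velocities"
  shows "A + B \<in> orth_velocities"
proof -
  obtain \<gamma> \<gamma>' where \<gamma>: "\<And>t. (\<gamma> has_vector_derivative \<gamma>' t) (at t)" "continuous_on UNIV \<gamma>'"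
    "\<And>t. orthogonal_matrix (\<gamma> t)" "\<gamma> 0 = mat 1" "\<gamma>' 0 = A"
    using assms(1) unfolding orth_velocities_def by blast
  obtain \<delta> \<delta>' where \<delta>: "\<And>t. (\<delta> has_vector_derivative \<delta>' t) (at t)" "continuous_on UNIV \<delta>'"
    "\<And>t. orthogonal_matrix (\<delta> t)" "\<delta> 0 = mat 1" "\<delta>' 0 = B"
    using assms(2) unfolding orth_velocities_def by blast
  have "continuous_on UNIV \<gamma>" "continuous_on UNIV \<delta>"
    using \<gamma>(1) \<delta>(1) by (meson continuous_at_imp_continuous_on has_vector_derivative_continuous)+
  then have "continuous_on UNIV (\<lambda>t. \<gamma> t ** \<delta>' t + \<gamma>' t ** \<delta> t)"
    using \<gamma>(2) \<delta>(2) by (intro continuous_on_add matrix_mult.continuous_on)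
  moreover have "((\<lambda>t. \<gamma> t ** \<delta> t) has_vector_derivative \<gamma> t ** \<delta>' t + \<gamma>' t ** \<delta> t) (at t)" for t
    by (rule matrix_mult.has_vector_derivative[OF \<gamma>(1) \<delta>(1)])
  moreover have "orthogonal_matrix (\<gamma> t ** \<delta> t)" for t
    by (intro orthogonal_matrix_mul \<gamma> \<delta>)
  ultimately show ?thesis
    unfolding orth_velocities_def
    by (intro CollectI exI[of _ "\<lambda>t. \<gamma> t ** \<delta> t"] exI[of _ "\<lambda>t. \<gamma> t ** \<delta>' t + \<gamma>' t ** \<delta> t"])
       (auto simp: \<gamma> \<delta> add.commute)
qed

text \<open>If \<open>A\<^sup>3 = - A\<close>, then \<open>exp (t A) = 1 + sin t A + (1 - cos t) A\<^sup>2\<close>.\<close>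

lemma orth_velocities_generator:
  assumes A: "skew_symmetric A" "A ** A ** A = - A"
  shows "c *\<^sub>R A \<in> orth_velocities"
proof -
  define \<gamma> where "\<gamma> t = mat 1 + sin (c * t) *\<^sub>R A + (1 - cos (c * t)) *\<^sub>R (A ** A)" for t
  define \<gamma>' where "\<gamma>' t = (c * cos (c * t)) *\<^sub>R A + (c * sin (c * t)) *\<^sub>R (A ** A)" for t
  have tA: "transpose A = - A"
    using A(1) by (simp add: skew_symmetric_def)
  have A3: "A ** (A ** A) = - A"
    using A(2) by (simp add: matrix_mul_assoc)
  have deriv: "(\<gamma> has_vector_derivative \<gamma>' t) (at t)" for t
    unfolding \<gamma>_def \<gamma>'_def by (auto intro!: derivative_eq_intros simp: mult_ac)
  have "orthogonal_matrix (\<gamma> t)" for t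
  proof -
    define s k where "s = sin (c * t)" and "k = 1 - cos (c * t)"
    \<comment> \<open>The left side is the coefficient of \<open>A ** A\<close> in
      \<open>transpose (\<gamma> t) ** \<gamma> t\<close>, once A^4 = - A^2 is used; it vanishes
      because sin^2 + cos^2 = 1.\<close>
    have rel: "2 * k - k * k - s * s = 0"
      unfolding s_def k_def using sin_cos_squared_add[of "c * t"] by (simp add: power2_eq_square algebra_simps)
    have "transpose (\<gamma> t) = mat 1 - s *\<^sub>R A + k *\<^sub>R (A ** A)"
      by (simp add: \<gamma>_def s_def k_def transpose_add transpose_scalar matrix_transpose_mul tA
          matrix_mult.minus_left matrix_mult.minus_right)
    moreover have "\<gamma> t = mat 1 + s *\<^sub>R A + k *\<^sub>R (A ** A)"
      by (simp add: \<gamma>_def s_def k_def)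
    ultimately have "transpose (\<gamma> t) ** \<gamma> t = mat 1 + (2 * k - k * k - s * s) *\<^sub>R (A ** A)"
      by (simp add: matrix_mult.add_left matrix_mult.add_right matrix_mult.diff_left
          matrix_mult.scaleR_left matrix_mult.scaleR_right A3 A(2)
          matrix_mult.minus_left matrix_mult.minus_right matrix_mul_assoc)
         (simp add: vec_eq_iff algebra_simps)
    then show ?thesis
      by (simp add: orthogonal_matrix rel)
  qed
  moreover have "continuous_on UNIV \<gamma>'"
    unfolding \<gamma>'_def by (intro continuous_intros)
  ultimately show ?thesis
    using deriv unfolding orth_velocities_def
    by (intro CollectI exI[of _ \<gamma>] exI[of _ \<gamma>']) (auto simp: \<gamma>_def \<gamma>'_def)
qed

lemma orth_velocities_sum:
  assumes "finite I" "\<And>i. i \<in> I \<Longrightarrow> f i \<in> orth_velocities"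
  shows "sum f I \<in> orth_velocities"
  using assms
proof (induction I rule: finite_induct)
  case empty
  show ?case
    using orth_velocities_generator[of 0 0] by (simp add: skew_symmetric_def transpose_zero)
next
  case (insert i I)
  then show ?case by (simp add: orth_velocities_add)
qed

text \<open>\<open>A\<close> is a linear combination of the generators \<open>R p q\<close> of
  rotations in coordinate planes, which satisfy R^3 = - R. Each unordered pair occurs twice in the
  double sum, hence the factor 1/2.\<close>

lemma skew_symmetric_imp_orth_velocity:
  fixes A :: "real^'d^'d"
  assumes "skew_symmetric A"
  shows "A \<in> orth_velocities"
proof -
  define R :: "'d \<Rightarrow> 'd \<Rightarrow> real^'d^'d"
    where "R p q = outer (axis p 1) (axis q 1) - outer (axis q 1) (axis p 1)" for p q
  have entry: "A $ i $ j = - A $ j $ i" for i j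
  proof -
    have "transpose A $ j $ i = (- A) $ j $ i"
      using assms by (simp add: skew_symmetric_def)
    then show ?thesis
      by (simp add: transpose_def)
  qed
  have "(\<Sum>p\<in>UNIV. \<Sum>q\<in>UNIV. (A $ p $ q / 2) *\<^sub>R R p q) $ i $ j = A $ i $ j" for i j
  proof -
    have coeff: "(A $ p $ q / 2) * (R p q $ i $ j)
      = (if q = j then if p = i then A $ i $ j / 2 else 0 else 0)
        - (if q = i then if p = j then A $ j $ i / 2 else 0 else 0)" for p q
      by (auto simp: R_def outer_def axis_def)
    have "(\<Sum>p\<in>UNIV. \<Sum>q\<in>UNIV. (A $ p $ q / 2) *\<^sub>R R p q) $ i $ j
      = (\<Sum>p\<in>UNIV. \<Sum>q\<in>UNIV. (A $ p $ q / 2) * (R p q $ i $ j))"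
      by simp
    also have "\<dots> = A $ i $ j / 2 - A $ j $ i / 2"
      unfolding coeff by (simp add: sum_subtractf)
    finally show ?thesis
      using entry[of i j] by simp
  qed
  then have "A = (\<Sum>p\<in>UNIV. \<Sum>q\<in>UNIV. (A $ p $ q / 2) *\<^sub>R R p q)"
    by (simp add: vec_eq_iff)
  moreover have "(\<Sum>p\<in>UNIV. \<Sum>q\<in>UNIV. (A $ p $ q / 2) *\<^sub>R R p q) \<in> orth_velocities"
  proof (intro orth_velocities_sum orth_velocities_generator)
    show "skew_symmetric (R p q)" for p q
      by (simp add: R_def skew_symmetric_def transpose_diff)
    show "R p q ** R p q ** R p q = - R p q" for p q
      by (cases "p = q") (simp_all add: R_def matrix_mult.diff_left matrix_mult.diff_right
          outer_mult_outer inner_axis_axis matrix_mult.minus_left)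
  qed simp_all
  ultimately show ?thesis
    by simp
qed

section \<open>Tangent spaces of tuples of orthogonal matrices\<close>

lemma bounded_linear_axis: "bounded_linear (axis i :: 'a::euclidean_space \<Rightarrow> 'a^'n)"
  unfolding linear_conv_bounded_linear[symmetric]
  by (rule linearI) (auto simp: vec_eq_iff axis_def)

lemma sum_axis_nth [simp]: "(\<Sum>i\<in>UNIV. axis i (f i)) $ j = f j"
  by (simp add: axis_def)

text \<open>Differentiating \<open>transpose U ** U = mat 1\<close> along a curve gives skew
  symmetry. Conversely, each block of a curve with the given velocity is the left translate by
  \<open>T $ i\<close> of a curve through the identity.\<close>

lemma tangent_space_orth_tuples:
  assumes T: "T \<in> orth_tuples"
  shows "tangent_space orth_tuples T = {v. \<forall>i. skew_symmetric (transpose (T $ i) ** v $ i)}"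
proof (intro set_eqI iffI)
  fix v assume "v \<in> tangent_space orth_tuples T"
  then obtain \<gamma> \<epsilon> where \<gamma>: "0 < \<epsilon>" "\<gamma> ` {-\<epsilon><..<\<epsilon>} \<subseteq> orth_tuples" "\<gamma> 0 = T"
    "(\<gamma> has_vector_derivative v) (at 0)"
    unfolding tangent_space_def by blast
  have "skew_symmetric (transpose (T $ i) ** v $ i)" for i
  proof -
    have comp: "((\<lambda>t. \<gamma> t $ i) has_vector_derivative v $ i) (at 0)"
      by (rule bounded_linear.has_vector_derivative[OF bounded_linear_vec_nth \<gamma>(4)])
    have "((\<lambda>t. transpose (\<gamma> t $ i) ** \<gamma> t $ i) has_vector_derivative
      transpose (\<gamma> 0 $ i) ** v $ i + transpose (v $ i) ** \<gamma> 0 $ i) (at 0)"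
      by (intro matrix_mult.has_vector_derivative comp
          bounded_linear.has_vector_derivative[OF bounded_linear_transpose])
    then have "((\<lambda>t. mat 1) has_vector_derivative
      transpose (\<gamma> 0 $ i) ** v $ i + transpose (v $ i) ** \<gamma> 0 $ i) (at 0)"
    proof (rule has_vector_derivative_transform_within_open[where S = "{-\<epsilon><..<\<epsilon>}"])
      show "transpose (\<gamma> t $ i) ** \<gamma> t $ i = mat 1" if "t \<in> {-\<epsilon><..<\<epsilon>}" for t
        using that \<gamma>(2) by (auto simp: orth_tuples_def orthogonal_matrix image_subset_iff)
    qed (use \<gamma>(1) in auto)
    then have "transpose (T $ i) ** v $ i + transpose (v $ i) ** T $ i = 0"
      using vector_derivative_unique_at[OF _ has_vector_derivative_const] \<gamma>(3) by metis
    then show ?thesis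
      by (simp add: skew_symmetric_def matrix_transpose_mul eq_neg_iff_add_eq_0 add.commute)
  qed
  then show "v \<in> {v. \<forall>i. skew_symmetric (transpose (T $ i) ** v $ i)}"
    by simp
next
  fix v assume "v \<in> {v. \<forall>i. skew_symmetric (transpose (T $ i) ** v $ i)}"
  then have "\<forall>i. transpose (T $ i) ** v $ i \<in> orth_velocities"
    by (simp add: skew_symmetric_imp_orth_velocity)
  then obtain \<gamma> \<gamma>' where \<gamma>: "\<And>i t. (\<gamma> i has_vector_derivative \<gamma>' i t) (at t)"
    "\<And>i. continuous_on UNIV (\<gamma>' i)" "\<And>i t. orthogonal_matrix (\<gamma> i t)" "\<And>i. \<gamma> i 0 = mat 1"
    "\<And>i. \<gamma>' i 0 = transpose (T $ i) ** v $ i"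
    unfolding orth_velocities_def mem_Collect_eq by metis
  \<comment> \<open>The tuple is assembled as a sum of \<open>axis i\<close> terms so that its
    derivative and continuity follow from rules for sums and bounded linear maps.\<close>
  define \<Gamma> where "\<Gamma> t = (\<Sum>i\<in>UNIV. axis i (T $ i ** \<gamma> i t))" for t
  define \<Gamma>' where "\<Gamma>' t = (\<Sum>i\<in>UNIV. axis i (T $ i ** \<gamma>' i t))" for t
  have orth: "transpose (T $ i) ** T $ i = mat 1" "T $ i ** transpose (T $ i) = mat 1" for i
    using T by (auto simp: orth_tuples_def orthogonal_matrix_def)
  have deriv: "(\<Gamma> has_vector_derivative \<Gamma>' t) (at t)" for t
    unfolding \<Gamma>_def \<Gamma>'_def
    by (intro has_vector_derivative_sum bounded_linear.has_vector_derivative[OF bounded_linear_axis]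
        bounded_linear.has_vector_derivative[OF matrix_mult.bounded_linear_right] \<gamma>(1))
  have "continuous_on UNIV \<Gamma>'"
    unfolding \<Gamma>'_def
    by (intro continuous_on_sum bounded_linear.continuous_on[OF bounded_linear_axis]
        bounded_linear.continuous_on[OF matrix_mult.bounded_linear_right] \<gamma>(2))
  then have "\<Gamma> C1_differentiable_on UNIV"
    using deriv unfolding C1_differentiable_on_def by blast
  then have "\<Gamma> C1_differentiable_on {-1<..<1}"
    by (rule C1_differentiable_on_subset) simp
  moreover have "\<Gamma> t \<in> orth_tuples" for t
    using T \<gamma>(3) by (simp add: orth_tuples_def \<Gamma>_def orthogonal_matrix_mul del: sum_component)
  moreover have "\<Gamma> 0 = T"
    by (simp add: \<Gamma>_def vec_eq_iff[of _ T] \<gamma>(4) del: sum_component)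
  moreover have "\<Gamma>' 0 = v"
    by (simp add: \<Gamma>'_def vec_eq_iff[of _ v] \<gamma>(5) matrix_mul_assoc orth del: sum_component)
  ultimately show "v \<in> tangent_space orth_tuples T"
    unfolding tangent_space_def using deriv[of 0]
    by (intro CollectI exI[of _ \<Gamma>] exI[of _ 1]) auto
qed

section \<open>Gradient and Hessian of an affine function\<close>

lemma subspace_tangent_space_orth_tuples:
  "T \<in> orth_tuples \<Longrightarrow> subspace (tangent_space orth_tuples T)"
  by (auto simp: tangent_space_orth_tuples subspace_def skew_symmetric_def matrix_mult.add_right
      transpose_add matrix_mult.scaleR_right transpose_scalar transpose_zero)

text \<open>Derivatives within a set are not unique in general. Composing with a curve in
  \<open>M\<close> that has velocity \<open>v\<close> leaves an ordinary one-variable derivative at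
  0, which determines the value at \<open>v\<close>.\<close>

lemma has_derivative_unique_tangent:
  fixes f :: "'a::euclidean_space \<Rightarrow> 'b::real_normed_vector"
  assumes "(f has_derivative f') (at p within M)" "(f has_derivative f'') (at p within M)"
    and v: "v \<in> tangent_space M p"
  shows "f' v = f'' v"
proof -
  obtain \<gamma> \<epsilon> where \<gamma>: "0 < \<epsilon>" "\<gamma> ` {-\<epsilon><..<\<epsilon>} \<subseteq> M" "\<gamma> 0 = p"
    "(\<gamma> has_vector_derivative v) (at 0)"
    using v unfolding tangent_space_def by blast
  have along: "((\<lambda>t. f (\<gamma> t)) has_vector_derivative g v) (at 0)"
    if g: "(f has_derivative g) (at p within M)" for g
  proof -
    have "(f has_derivative g) (at (\<gamma> 0) within \<gamma> ` {-\<epsilon><..<\<epsilon>})"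
      using has_derivative_subset[OF g \<gamma>(2)] \<gamma>(3) by simp
    moreover have "(\<gamma> has_derivative (\<lambda>h. h *\<^sub>R v)) (at 0 within {-\<epsilon><..<\<epsilon>})"
      using \<gamma>(4) by (simp add: has_vector_derivative_def has_derivative_at_withinI)
    ultimately have "((\<lambda>t. f (\<gamma> t)) has_derivative (\<lambda>h. g (h *\<^sub>R v))) (at 0 within {-\<epsilon><..<\<epsilon>})"
      using has_derivative_in_compose by blast
    then have "((\<lambda>t. f (\<gamma> t)) has_derivative (\<lambda>h. h *\<^sub>R g v)) (at 0 within {-\<epsilon><..<\<epsilon>})"
      by (simp add: linear_cmul[OF has_derivative_linear[OF g]])
    then show ?thesis
      using \<gamma>(1) by (simp add: has_vector_derivative_def at_within_open[where S = "{-\<epsilon><..<\<epsilon>}"])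
  qed
  show ?thesis
    using along[OF assms(1)] along[OF assms(2)] vector_derivative_unique_at by blast
qed

lemma frechet_derivative_tangent:
  fixes f :: "'a::euclidean_space \<Rightarrow> 'b::real_normed_vector"
  assumes f: "(f has_derivative f') (at p within M)" and v: "v \<in> tangent_space M p"
  shows "frechet_derivative f (at p within M) v = f' v"
  using has_derivative_unique_tangent[OF _ f v] f
  by (metis differentiableI frechet_derivative_works)

text \<open>Two candidates differ by a tangent vector that is orthogonal to every tangent vector,
  itself included, so the description in \<open>riem_grad\<close> has a unique solution.\<close>

lemma riem_grad_eqI:
  assumes sub: "subspace (tangent_space M p)"
    and f: "(f has_derivative f') (at p within M)"
    and g: "g \<in> tangent_space M p" "\<And>v. v \<in> tangent_space M p \<Longrightarrow> f' v = g \<bullet> v"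
  shows "riem_grad M f p = g"
  unfolding riem_grad_def
proof (rule the_equality)
  show "g \<in> tangent_space M p \<and>
    (\<forall>v\<in>tangent_space M p. frechet_derivative f (at p within M) v = g \<bullet> v)"
    using g frechet_derivative_tangent[OF f] by simp
next
  fix h assume h: "h \<in> tangent_space M p \<and>
    (\<forall>v\<in>tangent_space M p. frechet_derivative f (at p within M) v = h \<bullet> v)"
  then have "h - g \<in> tangent_space M p"
    using g(1) sub by (simp add: subspace_diff)
  then have "(h - g) \<bullet> (h - g) = 0"
    using h g(2) frechet_derivative_tangent[OF f] by (metis inner_diff_left right_minus_eq)
  then show "h = g" by simp
qed

lemma inner_orthogonal_matrix_mult:
  assumes "orthogonal_matrix T"
  shows "(T ** A) \<bullet> (T ** B) = A \<bullet> (B :: real^'d^'d)"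
  using assms by (simp add: inner_matrix_mult_left matrix_mul_assoc orthogonal_matrix)

text \<open>The gradient is the tangential projection of \<open>- K\<close>: after left translation
  by \<open>transpose (T $ i)\<close>, each block is replaced by its skew-symmetric part.\<close>

lemma riem_grad_linear_orth_tuples:
  fixes K :: "real^'d^'d^'v"
  assumes f: "\<And>T. T \<in> orth_tuples \<Longrightarrow> f T = c - K \<bullet> T" and T: "T \<in> orth_tuples"
  shows "riem_grad orth_tuples f T
    = (\<Sum>i\<in>UNIV. axis i ((1/2) *\<^sub>R (T $ i ** transpose (K $ i) ** T $ i - K $ i)))"
proof -
  have orth: "transpose (T $ i) ** T $ i = mat 1" "T $ i ** transpose (T $ i) = mat 1"
    "orthogonal_matrix (T $ i)" for i
    using T by (auto simp: orth_tuples_def orthogonal_matrix_def)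
  define g where "g = (\<Sum>i\<in>UNIV. axis i ((1/2) *\<^sub>R (T $ i ** transpose (K $ i) ** T $ i - K $ i)))"
  have Tg: "transpose (T $ i) ** g $ i
      = (1/2) *\<^sub>R (transpose (K $ i) ** T $ i - transpose (T $ i) ** K $ i)" for i
    by (simp add: g_def matrix_mult.scaleR_right matrix_mult.diff_right matrix_mul_assoc orth
        del: sum_component)
  have "- (K \<bullet> v) = g \<bullet> v" if "v \<in> tangent_space orth_tuples T" for v
  proof -
    have "- (K $ i \<bullet> v $ i) = g $ i \<bullet> v $ i" for i
    proof -
      define A where "A = transpose (T $ i) ** v $ i"
      define N where "N = transpose (T $ i) ** K $ i"
      have tA: "transpose A = - A"
        using that by (simp add: tangent_space_orth_tuples[OF T] skew_symmetric_def A_def)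
      have tN: "transpose N = transpose (K $ i) ** T $ i"
        by (simp add: N_def matrix_transpose_mul)
      have inner_v: "Y \<bullet> v $ i = (transpose (T $ i) ** Y) \<bullet> A" for Y
        using inner_orthogonal_matrix_mult[OF orth(3), of i "transpose (T $ i) ** Y" A]
        by (simp add: A_def matrix_mul_assoc orth)
      have "transpose N \<bullet> A = N \<bullet> transpose A"
        using inner_transpose_transpose[of N "transpose A"] by simp
      then have "transpose N \<bullet> A = - (N \<bullet> A)"
        by (simp add: tA)
      then show ?thesis
        unfolding inner_v Tg N_def[symmetric] tN[symmetric] by (simp add: inner_diff_left)
    qed
    then show ?thesis
      unfolding inner_vec_def[of K v] inner_vec_def[of g v] by (simp flip: sum_negf)
  qed
  moreover have "skew_symmetric (transpose (T $ i) ** g $ i)" for i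
    unfolding Tg by (simp add: skew_symmetric_def transpose_scalar transpose_diff matrix_transpose_mul
        flip: scaleR_minus_right)
  then have "g \<in> tangent_space orth_tuples T"
    unfolding tangent_space_orth_tuples[OF T] by blast
  moreover have "(f has_derivative (\<lambda>h. - (K \<bullet> h))) (at T within orth_tuples)"
  proof (rule has_derivative_transform[OF T f])
    show "((\<lambda>T. c - K \<bullet> T) has_derivative (\<lambda>h. - (K \<bullet> h))) (at T within orth_tuples)"
      by (auto intro!: derivative_eq_intros)
  qed
  ultimately show ?thesis
    unfolding g_def[symmetric]
    by (intro riem_grad_eqI[OF subspace_tangent_space_orth_tuples[OF T]])
qed

text \<open>For a tangent vector with blocks \<open>T $ i ** A\<close>, the derivative of the
  gradient has as blocks half of \<open>T $ i ** (A ** P $ i + P $ i ** A)\<close>. The kernel of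
  the Hessian is therefore, block by block, that of the anticommutator with \<open>P $ i\<close> on
  skew-symmetric matrices.\<close>

lemma hessian_nonsingular_linear_orth_tuples:
  fixes K P :: "real^'d^'d^'v"
  assumes f: "\<And>T. T \<in> orth_tuples \<Longrightarrow> f T = c - K \<bullet> T" and T: "T \<in> orth_tuples"
    and K: "\<And>i. K $ i = T $ i ** P $ i" and P: "\<And>i. transpose (P $ i) = P $ i"
  shows "hessian_nonsingular orth_tuples f T
    \<longleftrightarrow> (\<forall>i A. skew_symmetric A \<and> A ** P $ i + P $ i ** A = 0 \<longrightarrow> A = 0)"
proof -
  have orth: "transpose (T $ i) ** T $ i = mat 1" "T $ i ** transpose (T $ i) = mat 1"
    "orthogonal_matrix (T $ i)" for i
    using T by (auto simp: orth_tuples_def orthogonal_matrix_def)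
  have orth': "X ** transpose (T $ i) ** T $ i = X" for i and X :: "real^'d^'d"
    by (metis matrix_mul_assoc matrix_mul_rid orth(1))
  have cancel: "T $ i ** X = 0 \<longleftrightarrow> X = 0" "transpose (T $ i) ** X = 0 \<longleftrightarrow> X = 0"
    for i and X :: "real^'d^'d"
  proof -
    have "transpose (T $ i) ** (T $ i ** X) = X" "T $ i ** (transpose (T $ i) ** X) = X"
      by (simp_all add: matrix_mul_assoc orth)
    then show "T $ i ** X = 0 \<longleftrightarrow> X = 0" "transpose (T $ i) ** X = 0 \<longleftrightarrow> X = 0"
      by (metis times0_right)+
  qed
  define G where "G T = (\<Sum>i\<in>UNIV. axis i ((1/2) *\<^sub>R (T $ i ** transpose (K $ i) ** T $ i - K $ i)))"
    for T :: "real^'d^'d^'v"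
  define G' where "G' u = (\<Sum>i\<in>UNIV. axis i ((1/2) *\<^sub>R
      (T $ i ** transpose (K $ i) ** u $ i + u $ i ** transpose (K $ i) ** T $ i)))" for u
  have vec_nth: "((\<lambda>T. T $ i) has_derivative (\<lambda>u. u $ i)) F" for i and F :: "(real^'d^'d^'v) filter"
    by (rule bounded_linear_imp_has_derivative[OF bounded_linear_vec_nth])
  have "(G has_derivative G') (at T within orth_tuples)"
    unfolding G_def G'_def
  proof (intro has_derivative_sum bounded_linear.has_derivative[OF bounded_linear_axis]
      has_derivative_scaleR_right)
    show "((\<lambda>T. T $ i ** transpose (K $ i) ** T $ i - K $ i) has_derivative
        (\<lambda>u. T $ i ** transpose (K $ i) ** u $ i + u $ i ** transpose (K $ i) ** T $ i))
        (at T within orth_tuples)" for i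
      using has_derivative_diff[OF matrix_mult.FDERIV[OF
            bounded_linear.has_derivative[OF matrix_mult.bounded_linear_left vec_nth] vec_nth]
          has_derivative_const]
      by simp
  qed
  moreover have "riem_grad orth_tuples f U = G U" if "U \<in> orth_tuples" for U
    unfolding G_def by (rule riem_grad_linear_orth_tuples[OF f that])
  ultimately have "(riem_grad orth_tuples f has_derivative G') (at T within orth_tuples)"
    using has_derivative_transform[OF T] by blast
  then have hess: "riem_hessian orth_tuples f T u v = G' u \<bullet> v"
    if "u \<in> tangent_space orth_tuples T" for u v
    unfolding riem_hessian_def using frechet_derivative_tangent that by metis
  define op where "op A i = A ** P $ i + P $ i ** A" for A i
  have G': "G' u $ i = (1/2) *\<^sub>R (T $ i ** op (transpose (T $ i) ** u $ i) i)" for u i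
    by (simp add: G'_def op_def K matrix_transpose_mul P matrix_mult.add_right
        matrix_mul_assoc orth orth' add.commute del: sum_component)
  have skew_op: "skew_symmetric (op A i)" if "skew_symmetric A" for A i
    using that by (simp add: skew_symmetric_def op_def transpose_add matrix_transpose_mul P
        matrix_mult.minus_left matrix_mult.minus_right)
  have tangent: "u \<in> tangent_space orth_tuples T \<longleftrightarrow> (\<forall>i. skew_symmetric (transpose (T $ i) ** u $ i))" for u
    by (simp add: tangent_space_orth_tuples[OF T])
  \<comment> \<open>Tangency makes \<open>G' u\<close> itself a test vector, so a Hessian that
    vanishes against all tangent vectors forces \<open>G' u = 0\<close>.\<close>
  have G'_tangent: "G' u \<in> tangent_space orth_tuples T" if "u \<in> tangent_space orth_tuples T" for u
  proof -
    have "transpose (T $ i) ** G' u $ i = (1/2) *\<^sub>R op (transpose (T $ i) ** u $ i) i" for i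
      by (simp add: G' matrix_mult.scaleR_right matrix_mul_assoc orth)
    then show ?thesis
      using that skew_op unfolding tangent
      by (simp add: skew_symmetric_def transpose_scalar)
  qed
  have kernel: "(\<forall>v\<in>tangent_space orth_tuples T. riem_hessian orth_tuples f T u v = 0)
      \<longleftrightarrow> (\<forall>i. op (transpose (T $ i) ** u $ i) i = 0)"
    if u: "u \<in> tangent_space orth_tuples T" for u
  proof -
    have "(\<forall>v\<in>tangent_space orth_tuples T. riem_hessian orth_tuples f T u v = 0) \<longleftrightarrow> G' u = 0"
      using hess[OF u] G'_tangent[OF u] by (metis inner_eq_zero_iff inner_zero_left)
    also have "\<dots> \<longleftrightarrow> (\<forall>i. op (transpose (T $ i) ** u $ i) i = 0)"
      by (simp add: vec_eq_iff[of "G' u"] G' cancel)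
    finally show ?thesis .
  qed
  show ?thesis
    unfolding op_def[symmetric]
  proof
    assume ns: "hessian_nonsingular orth_tuples f T"
    show "\<forall>i A. skew_symmetric A \<and> op A i = 0 \<longrightarrow> A = 0"
    proof (intro allI impI)
      fix i A assume A: "skew_symmetric A \<and> op A i = 0"
      define u where "u = axis i (T $ i ** A)"
      have Tu: "transpose (T $ j) ** u $ j = (if j = i then A else 0)" for j
        by (simp add: u_def axis_def matrix_mul_assoc orth)
      have "u \<in> tangent_space orth_tuples T"
        using A by (simp add: tangent Tu skew_symmetric_def transpose_zero)
      moreover have "\<forall>j. op (transpose (T $ j) ** u $ j) j = 0"
        using A by (simp add: Tu op_def)
      ultimately have "u = 0"
        using ns kernel unfolding hessian_nonsingular_def by blast
      then show "A = 0"
        using Tu[of i] by simp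
    qed
  next
    assume inj: "\<forall>i A. skew_symmetric A \<and> op A i = 0 \<longrightarrow> A = 0"
    have "u = 0" if u: "u \<in> tangent_space orth_tuples T"
      and ker: "\<forall>v\<in>tangent_space orth_tuples T. riem_hessian orth_tuples f T u v = 0" for u
    proof -
      have "transpose (T $ i) ** u $ i = 0" for i
        using inj u ker kernel[OF u] tangent by blast
      then have "u $ i = 0" for i
        by (simp only: cancel)
      then show ?thesis
        by (simp add: vec_eq_iff[of u])
    qed
    then show "hessian_nonsingular orth_tuples f T"
      unfolding hessian_nonsingular_def by blast
  qed
qed

section \<open>Skew-symmetric matrices and the rank of a Gram matrix\<close>

definition gram :: "'k set \<Rightarrow> ('k \<Rightarrow> real^'d) \<Rightarrow> real^'d^'d" where
  "gram J a = (\<Sum>k\<in>J. outer (a k) (a k))"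

lemma transpose_gram: "transpose (gram J a) = gram J a"
  by (simp add: gram_def transpose_sum)

lemma skew_symmetric_inner:
  assumes "skew_symmetric A"
  shows "u \<bullet> (A *v v) = - ((A *v u) \<bullet> v)"
proof -
  have "u \<bullet> (A *v v) = (- A *v u) \<bullet> v"
    using assms inner_transpose_mult[of A u v] unfolding skew_symmetric_def by simp
  then show ?thesis
    by (simp add: linear_neg[OF bounded_linear.linear[OF bounded_linear_matrix_vector_left]])
qed

text \<open>Each rank-one term contributes \<open>(norm (A *v u))\<^sup>2\<close> from either
  product; in the second, skew symmetry enters twice and the signs cancel. For finite
  \<open>J\<close>, the anticommutator thus vanishes only if \<open>A\<close> kills every
  \<open>a k\<close>.\<close>

lemma gram_anticommutator_inner:
  assumes "skew_symmetric A"
  shows "(A ** gram J a + gram J a ** A) \<bullet> A = 2 * (\<Sum>k\<in>J. (norm (A *v a k))\<^sup>2)"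
proof -
  have "(A ** outer u u + outer u u ** A) \<bullet> A = 2 * (norm (A *v u))\<^sup>2" for u
  proof -
    have "(A ** outer u u) \<bullet> A = (norm (A *v u))\<^sup>2"
      by (simp add: mult_outer outer_inner power2_norm_eq_inner)
    moreover have "outer u u ** A = - outer u (A *v u)"
      using assms by (simp add: outer_mult skew_symmetric_def del: transpose_matrix_vector)
        (simp add: vec_eq_iff outer_def matrix_vector_mult_def sum_negf)
    then have "(outer u u ** A) \<bullet> A = (norm (A *v u))\<^sup>2"
      using skew_symmetric_inner[OF assms, of u "A *v u"]
      by (simp add: outer_inner power2_norm_eq_inner)
    ultimately show ?thesis
      by (simp add: inner_add_left)
  qed
  then show ?thesis
    by (simp add: gram_def matrix_mult.sum_left matrix_mult.sum_right inner_sum_left sum_distrib_left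
        flip: sum.distrib)
qed

text \<open>The range of a skew-symmetric matrix is orthogonal to its kernel and its rank is never
  1, so a kernel of codimension at most 1 leaves only the zero matrix. In codimension at least 2,
  two orthogonal vectors of the complement give a nonzero one.\<close>

lemma gram_anticommutator_injective_iff:
  fixes a :: "'k \<Rightarrow> real^'d"
  assumes fin: "finite J"
  shows "(\<forall>A. skew_symmetric A \<and> A ** gram J a + gram J a ** A = 0 \<longrightarrow> A = 0)
    \<longleftrightarrow> CARD('d) - 1 \<le> dim (span (a ` J))"
    (is "?inj \<longleftrightarrow> ?rank")
proof
  assume ?rank
  show ?inj
  proof (intro allI impI)
    fix A :: "real^'d^'d" assume A: "skew_symmetric A \<and> A ** gram J a + gram J a ** A = 0"
    then have "(\<Sum>k\<in>J. (norm (A *v a k))\<^sup>2) = 0"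
      using gram_anticommutator_inner[of A J a] by simp
    then have "A *v a k = 0" if "k \<in> J" for k
      using that fin by (simp add: sum_nonneg_eq_0_iff)
    then have ker: "A *v v = 0" if "v \<in> span (a ` J)" for v
      using that linear_eq_0_on_span[OF matrix_vector_mul_linear, of "a ` J" A] by auto
    have "A *v y = 0" for y
    proof (rule ccontr)
      define w where "w = A *v y"
      assume "A *v y \<noteq> 0"
      then have w0: "w \<noteq> 0" by (simp add: w_def)
      have wV: "w \<bullet> v = 0" if "v \<in> span (a ` J)" for v
        using skew_symmetric_inner[of A v y] A ker[OF that] by (simp add: w_def inner_commute)
      have wy: "w \<bullet> y = 0"
        using skew_symmetric_inner[of A y y] A by (simp add: w_def inner_commute)
      \<comment> \<open>\<open>w\<close> is orthogonal to the span, so together they fill the whole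
        space; as \<open>y\<close> is orthogonal to \<open>w\<close> too, \<open>y\<close> lies in
        the span, where \<open>A\<close> vanishes.\<close>
      have "w \<notin> span (a ` J)"
        using wV[of w] w0 by auto
      then have "dim (insert w (a ` J)) \<ge> CARD('d)"
        using \<open>?rank\<close> by (simp add: dim_insert)
      then have "y \<in> span (insert w (a ` J))"
        using dim_eq_full[of "insert w (a ` J)"] dim_subset_UNIV[of "insert w (a ` J)"] by simp
      then obtain c where c: "y - c *\<^sub>R w \<in> span (a ` J)"
        using span_breakdown_eq by blast
      then have "w \<bullet> (y - c *\<^sub>R w) = 0"
        by (rule wV)
      then have "c = 0"
        using w0 wy by (simp add: inner_diff_right)
      then show False
        using c ker[of y] \<open>A *v y \<noteq> 0\<close> by simp
    qed
    then show "A = 0"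
      by (simp add: matrix_eq)
  qed
next
  assume inj: ?inj
  show ?rank
  proof (rule ccontr)
    assume "\<not> ?rank"
    then have dim: "dim (a ` J) < CARD('d) - 1" by simp
    then have "dim (a ` J) < DIM(real^'d)" by simp
    then obtain u where u: "u \<noteq> 0" "\<And>y. y \<in> span (a ` J) \<Longrightarrow> orthogonal u y"
      using orthogonal_to_subspace_exists by blast
    \<comment> \<open>One added vector raises the dimension by at most 1, so the strict bound by
      \<open>CARD('d) - 1\<close> leaves room for a second one.\<close>
    have "dim (insert u (a ` J)) < DIM(real^'d)"
      using dim dim_insert[of u "a ` J"] by (simp split: if_splits)
    then obtain w where w: "w \<noteq> 0" "\<And>y. y \<in> span (insert u (a ` J)) \<Longrightarrow> orthogonal w y"
      using orthogonal_to_subspace_exists by blast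
    have perp: "u \<bullet> a k = 0" "w \<bullet> a k = 0" if "k \<in> J" for k
      using that u(2) w(2) by (auto simp: orthogonal_def span_base)
    have wu: "w \<bullet> u = 0"
      using w(2) by (auto simp: orthogonal_def span_base)
    define A where "A = outer u w - outer w u"
    have tA: "transpose A = - A"
      by (simp add: A_def transpose_diff)
    have "A ** gram J a = 0"
      by (simp add: gram_def A_def matrix_mult.sum_right matrix_mult.diff_left outer_mult_outer perp)
    moreover from this have "gram J a ** A = 0"
      using matrix_transpose_mul[of A "gram J a"]
      by (simp add: tA transpose_gram matrix_mult.minus_right transpose_zero)
    ultimately have "A ** gram J a + gram J a ** A = 0"
      by simp
    then have "A = 0"
      using inj tA unfolding skew_symmetric_def by blast
    then have "A *v w = 0" by simp
    then have "(w \<bullet> w) *\<^sub>R u = 0"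
      using wu by (simp add: A_def matrix_vector_mult_diff_rdistrib outer_mult_vec inner_commute)
    then show False
      using u(1) w(1) by simp
  qed
qed

section \<open>Two views\<close>

lemma UNIV_eq_singleton_if_card_option:
  assumes "CARD('r::finite option) = 2"
  shows "(UNIV :: 'r set) = {r}"
proof -
  have "CARD('r) = 1"
    using assms by simp
  then have "is_singleton (UNIV :: 'r set)"
    by (simp add: is_singleton_altdef)
  then show ?thesis
    by (metis UNIV_I is_singleton_def singletonD)
qed

theorem theorem4p4:
  fixes E :: "('n::{finite,linorder} \<times> 'r::finite option) set"
    and x :: "'n \<Rightarrow> 'r option \<Rightarrow> real^'d"
    and S :: "real^'d^'d^('r option)"
    and r :: 'r
  assumes two_views: "CARD('r option) = 2"
    and connected: "graph_connected E"
    and nondeg_views: "\<And>i. affinely_nondegenerate_view E x i"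
    and perfect: "perfect_alignment E x S"
  shows "nondegenerate_alignment E x S \<longleftrightarrow>
         cols_rank (center_cols (overlap_cols E x None (Some r))) \<ge> CARD('d) - 1"
proof -
  define J where "J = overlap E None (Some r)"
  define a where "a = centered_view E x None (Some r) None"
  define b where "b = centered_view E x None (Some r) (Some r)"
  have UNIV_r: "(UNIV :: 'r set) = {r}"
    by (rule UNIV_eq_singleton_if_card_option[OF two_views])
  then have UNIV_views: "(UNIV :: 'r option set) = {None, Some r}"
    by (auto simp: UNIV_option_conv)
  have cost: "align_F E x U = (\<Sum>k\<in>J. (norm (transpose (U $ None) *v a k
      - transpose (U $ Some r) *v b k))\<^sup>2) / 2" for U
    using align_F_two_views[OF _ UNIV_views, of E x U] by (simp add: J_def a_def b_def)
  define T where "T = quot_proj S"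
  have T_r: "T $ r = S $ Some r ** transpose (S $ None)"
    by (simp add: T_def quot_proj_def)
  have S: "orthogonal_matrix (S $ v)" for v
    using perfect by (simp add: perfect_alignment_def orth_tuples_def)
  have T: "T \<in> orth_tuples"
    by (simp add: T_def quot_proj_def orth_tuples_def orthogonal_matrix_mul S)
  have quot_F: "quot_F E x U = (\<Sum>k\<in>J. (norm (a k - transpose (U $ r) *v b k))\<^sup>2) / 2" for U
    using cost[of "cons_id U"] by (simp add: quot_F_def align_F_def cons_id_def)
  \<comment> \<open>The cost is a sum of squares, so perfection aligns every common point
    exactly.\<close>
  have b: "b k = T $ r *v a k" if "k \<in> J" for k
  proof -
    have "(\<Sum>k\<in>J. (norm (transpose (S $ None) *v a k - transpose (S $ Some r) *v b k))\<^sup>2) = 0"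
      using perfect cost[of S] by (simp add: perfect_alignment_def)
    then have "transpose (S $ None) *v a k = transpose (S $ Some r) *v b k"
      using that by (simp add: sum_nonneg_eq_0_iff del: transpose_matrix_vector)
    then have "S $ Some r *v (transpose (S $ None) *v a k) = S $ Some r *v (transpose (S $ Some r) *v b k)"
      by simp
    then show ?thesis
      using S[of "Some r"] by (simp only: matrix_vector_mul_assoc T_r orthogonal_matrix_def matrix_vector_mul_lid)
  qed
  have min: "local_minimizer_on orth_tuples (quot_F E x) T"
  proof -
    have "quot_F E x T = 0"
      using T by (simp add: quot_F b matrix_vector_mul_assoc orth_tuples_def orthogonal_matrix
          del: transpose_matrix_vector)
    moreover have "quot_F E x U \<ge> 0" for U
      by (simp add: quot_F sum_nonneg)
    ultimately show ?thesis
      unfolding local_minimizer_on_def using T by (metis zero_less_one)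
  qed
  \<comment> \<open>There is only one view besides the first, so these families have the single
    index \<open>r\<close> and may be taken constant.\<close>
  define P where "P = (\<chi> i::'r. gram J a)"
  define K where "K = (\<chi> i::'r. T $ r ** gram J a)"
  have K_r: "K $ r = (\<Sum>k\<in>J. outer (b k) (a k))"
    by (simp add: K_def gram_def matrix_mult.sum_right mult_outer b)
  \<comment> \<open>On orthogonal blocks the norm of \<open>transpose (U $ r) *v b k\<close> is that
    of \<open>b k\<close>, so the cost loses its quadratic part and becomes affine in
    \<open>U\<close>.\<close>
  have linear: "quot_F E x U = (\<Sum>k\<in>J. (norm (a k))\<^sup>2 + (norm (b k))\<^sup>2) / 2 - K \<bullet> U"
    if U: "U \<in> orth_tuples" for U
  proof -
    have orth: "orthogonal_matrix (U $ r)"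
      using U by (simp add: orth_tuples_def)
    have "(norm (a k - transpose (U $ r) *v b k))\<^sup>2
      = (norm (a k))\<^sup>2 + (norm (b k))\<^sup>2 - 2 * (outer (b k) (a k) \<bullet> U $ r)" for k
    proof -
      have "(norm (transpose (U $ r) *v b k))\<^sup>2 = (norm (b k))\<^sup>2"
        unfolding power2_norm_eq_inner inner_transpose_mult
        using orth by (simp add: matrix_vector_mul_assoc orthogonal_matrix_def del: transpose_matrix_vector)
      moreover have "a k \<bullet> (transpose (U $ r) *v b k) = outer (b k) (a k) \<bullet> U $ r"
        by (metis inner_commute inner_transpose_mult outer_inner)
      ultimately show ?thesis
        by (simp add: power2_norm_eq_inner inner_diff_left inner_diff_right inner_commute
            del: transpose_matrix_vector)
    qed
    moreover have "K \<bullet> U = (\<Sum>k\<in>J. outer (b k) (a k) \<bullet> U $ r)"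
      by (simp add: inner_vec_def[of K U] UNIV_r K_r inner_sum_left)
    ultimately show ?thesis
      by (simp add: quot_F sum_subtractf sum_distrib_left[symmetric] diff_divide_distrib)
  qed
  have "hessian_nonsingular orth_tuples (quot_F E x) T
    \<longleftrightarrow> (\<forall>(i::'r) A. skew_symmetric A \<and> A ** P $ i + P $ i ** A = 0 \<longrightarrow> A = 0)"
  proof (rule hessian_nonsingular_linear_orth_tuples[OF linear T])
    show "K $ i = T $ i ** P $ i" for i
      using UNIV_r by (auto simp: K_def P_def)
    show "transpose (P $ i) = P $ i" for i
      by (simp add: P_def transpose_gram)
  qed
  also have "\<dots> \<longleftrightarrow> CARD('d) - 1 \<le> dim (span (a ` J))"
    using gram_anticommutator_injective_iff[of J a] by (simp add: P_def)
  finally show ?thesis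
    using min
    by (simp add: nondegenerate_alignment_def cols_rank_center_overlap T_def a_def J_def)
qed

end
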